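(* For every $\theta\in\mathbb R$, $\sqrt{n}(\hat\theta_n-\theta)$ converges in distribution, as $n\to\infty$, to the normal distribution $N\!\left(0,\dfrac{m+1}{m(2m-1)}\right)$.
   Context: Fix $m>1/2$. Let $c_m:=\left(\int_{\mathbb R}(1+x^2)^{-m}\,dx\right)^{-1}$ and $f(x):=c_m(1+x^2)^{-m}$. For $\theta\in\mathbb R$, $\mathrm{PVII}_m(\theta,1)$ denotes the Pearson Type VII distribution with location $\theta$ and scale $1$, i.e. the law with density $x\mapsto f(x-\theta)$. Let $(X_n)_{n\ge1}$ be i.i.d. random variables on a probability space $(\Omega,\mathcal F,P)$ with law $\mathrm{PVII}_m(\theta,1)$. For each $n$, let $\hat\theta_n(x_1,\dots,x_n)$ be any Borel measurable function on $\mathbb R^n$ such that $\hat\theta_n(x_1,\dots,x_n)$ is a maximizer of $t\mapsto\prod_{i=1}^n f(x_i-t)$ over $t\in\mathbb R$, and let $\hat\theta_n:=\hat\theta_n(X_1,\dots,X_n)$ (the maximum likelihood estimator). $N(\mu,\sigma^2)$ is the normal distribution with mean $\mu$ and variance $\sigma^2$. *)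

theory Defs
  imports "HOL-Probability.Probability"
begin

definition pvii_const :: "real \<Rightarrow> real" where
  "pvii_const m = 1 / (\<integral>x. (1 + x\<^sup>2) powr (- m) \<partial>lborel)"

definition pvii_density :: "real \<Rightarrow> real \<Rightarrow> real" where
  "pvii_density m x = pvii_const m * (1 + x\<^sup>2) powr (- m)"

definition pvii_distribution :: "real \<Rightarrow> real \<Rightarrow> real measure" where
  "pvii_distribution m \<theta> = density lborel (\<lambda>x. ennreal (pvii_density m (x - \<theta>)))"

definition normal_distribution :: "real \<Rightarrow> real \<Rightarrow> real measure" where
  "normal_distribution \<mu> s = density lborel (\<lambda>x. ennreal (normal_density \<mu> s x))"

end

theory Submission
  imports Defs "HOL-Real_Asymp.Real_Asymp"
begin

text \<open>
  Write \<open>Y\<^sub>i = X\<^sub>i - \<theta>\<close> and let \<open>T\<^sub>n\<close> be the estimation error. Maximizing the likelihood means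
  minimizing \<open>\<Sum>i<n. ln (1 + (Y\<^sub>i - t)\<^sup>2)\<close>. This function of \<open>t\<close> is not convex, so consistency of \<open>T\<^sub>n\<close> is
  shown by Wald's argument: for large \<open>\<bar>t\<bar>\<close> one square integrable lower bound works uniformly, and on
  the remaining compact set Gibbs' inequality, the weak law at finitely many points and the
  Lipschitz dependence on \<open>t\<close> suffice. A Taylor expansion of the score equation
  \<open>\<Sum>i<n. \<psi>(Y\<^sub>i - T\<^sub>n) = 0\<close> with \<open>\<psi>(x) = 2x/(1+x\<^sup>2)\<close> then shows that \<open>\<surd>n T\<^sub>n\<close> is asymptotically
  \<open>(\<Sum>i<n. \<psi>(Y\<^sub>i)) / (\<surd>n J)\<close> with \<open>J = E \<psi>'(Y) = (2m-1)/(m+1)\<close>, and the central limit theorem with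
  \<open>E \<psi>(Y)\<^sup>2 = (2m-1)/(m(m+1))\<close> and Slutsky's theorem finish the proof. Both moments follow from the
  recurrence for \<open>\<integral>(1+x\<^sup>2)\<^sup>-\<^sup>k\<close>.
\<close>

section \<open>The Pearson type VII law\<close>

text \<open>On \<open>{1..}\<close> the function is dominated by \<open>x powr (-2*k)\<close>, whose
  exponent is below -1. Reflection handles \<open>{..-1}\<close>, and continuity handles the compact
  interval in between.\<close>

lemma integrable_powr_one_plus_square:
  assumes k: "k > 1/2"
  shows "integrable lborel (\<lambda>x::real. (1 + x\<^sup>2) powr (- k))"
proof -
  let ?f = "\<lambda>x::real. (1 + x\<^sup>2) powr (- k)"
  have "(\<lambda>x. x powr (-2*k)) integrable_on {1..}"
    using has_integral_powr_to_inf[of "-2*k" 1] k by (auto simp: integrable_on_def)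
  then have "(\<lambda>x. x powr (-2*k)) absolutely_integrable_on {1..}"
    by (rule nonnegative_absolutely_integrable_1) auto
  then have "set_integrable lborel {1..} (\<lambda>x. x powr (-2*k))"
    unfolding set_integrable_def by (subst integrable_completion[symmetric]) auto
  then have i1: "set_integrable lborel {1..} ?f"
  proof (rule set_integrable_bound)
    show "AE x in lborel. x \<in> {1..} \<longrightarrow> norm (?f x) \<le> norm (x powr (-2*k))"
    proof (intro AE_I2 impI)
      fix x :: real assume x: "x \<in> {1..}"
      have "?f x \<le> (x\<^sup>2) powr (-k)"
        using x k by (intro powr_mono2') auto
      also have "\<dots> = x powr (-2*k)"
        using x powr_powr[of x 2 "-k"] by (simp add: powr_numeral)
      finally show "norm (?f x) \<le> norm (x powr (-2*k))" by simp
    qed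
  qed (auto simp: set_borel_measurable_def)
  have "set_integrable lborel {..-1} ?f"
    using i1 lborel_integrable_real_affine[of "\<lambda>x. indicator {1..} x *\<^sub>R ?f x" "-1" 0]
    unfolding set_integrable_def
    by (auto simp: indicator_def conj_commute le_minus_iff cong: if_cong)
  moreover have "set_integrable lborel {-1..1} ?f"
    by (intro borel_integrable_atLeastAtMost')
       (auto intro!: continuous_intros simp: add_nonneg_eq_0_iff)
  ultimately have "set_integrable lborel ({..-1} \<union> {-1..1} \<union> {1..}) ?f"
    by (intro set_integrable_Un i1) auto
  also have "{..-1} \<union> {-1..1} \<union> {1..} = (UNIV :: real set)" by auto
  finally show ?thesis by (simp add: set_integrable_def)
qed

text \<open>The function \<open>x * (1 + x\<^sup>2) powr (- k)\<close> tends to 0 at both infinities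
  because \<open>2 * k > 1\<close>, so its derivative integrates to 0. Writing
  \<open>x\<^sup>2\<close> as \<open>(1 + x\<^sup>2) - 1\<close> turns that derivative into a
  combination of the two powers to be compared.\<close>

lemma integral_powr_one_plus_square_recurrence:
  assumes k: "k > 1/2"
  shows "(\<integral>x. (1 + x\<^sup>2) powr (- (k + 1)) \<partial>lborel) =
    (2 * k - 1) / (2 * k) * (\<integral>x. (1 + (x::real)\<^sup>2) powr (- k) \<partial>lborel)"
proof -
  let ?F = "\<lambda>x::real. x * (1 + x\<^sup>2) powr (- k)"
  let ?f = "\<lambda>x::real. (1 - 2 * k) * (1 + x\<^sup>2) powr (- k) + 2 * k * (1 + x\<^sup>2) powr (- (k + 1))"
  have int: "integrable lborel ?f"
    using k by (intro Bochner_Integration.integrable_add integrable_mult_right integrable_powr_one_plus_square) auto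
  have "(LBINT x=-\<infinity>..\<infinity>. ?f x) = 0 - 0"
  proof (rule interval_integral_FTC_integrable)
    fix x :: real
    have pos: "1 + x\<^sup>2 > 0" by (simp add: add_pos_nonneg)
    have eq: "(1 + x\<^sup>2) powr (- k) = (1 + x\<^sup>2) powr (- (k + 1)) * (1 + x\<^sup>2)"
      using pos powr_add[of "1 + x\<^sup>2" "-(k+1)" 1] by simp
    have "(?F has_real_derivative
        ((1 + x\<^sup>2) powr (- k) + x * (- k * (1 + x\<^sup>2) powr (- k - 1) * (2 * x)))) (at x)"
      using pos by (auto intro!: derivative_eq_intros)
    also have "(1 + x\<^sup>2) powr (- k) + x * (- k * (1 + x\<^sup>2) powr (- k - 1) * (2 * x)) = ?f x"
      by (simp add: eq) (simp add: algebra_simps power2_eq_square)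
    finally show "(?F has_vector_derivative ?f x) (at x)"
      by (simp add: has_real_derivative_iff_has_vector_derivative)
    show "isCont ?f x"
      using pos by (intro continuous_intros) auto
  next
    have "((\<lambda>x::real. x * (1 + x\<^sup>2) powr (- k)) \<longlongrightarrow> 0) at_top"
         "((\<lambda>x::real. x * (1 + x\<^sup>2) powr (- k)) \<longlongrightarrow> 0) at_bot"
      using k by real_asymp+
    then show "((?F \<circ> real_of_ereal) \<longlongrightarrow> 0) (at_right (-\<infinity>))" 
       "((?F \<circ> real_of_ereal) \<longlongrightarrow> 0) (at_left \<infinity>)"
      by (simp_all add: ereal_tendsto_simps)
  qed (use int in \<open>auto simp: set_integrable_def\<close>)
  then have "(\<integral>x. ?f x \<partial>lborel) = 0"
    by (simp add: interval_lebesgue_integral_def set_lebesgue_integral_def)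
  also have "(\<integral>x. ?f x \<partial>lborel) = (1 - 2 * k) * (\<integral>x. (1 + x\<^sup>2) powr (- k) \<partial>lborel)
      + 2 * k * (\<integral>x. (1 + x\<^sup>2) powr (- (k + 1)) \<partial>lborel)"
    using k by (subst Bochner_Integration.integral_add)
      (auto intro!: integrable_mult_right integrable_powr_one_plus_square simp del: minus_add_distrib)
  finally show ?thesis using k by (simp add: field_simps)
qed

section \<open>The score function and its bounds\<close>

lemma one_plus_square_pos: "0 < 1 + (x::real)\<^sup>2"
  by (simp add: add_pos_nonneg)

lemma abs_le_one_plus_square: "2 * \<bar>x\<bar> \<le> 1 + (x::real)\<^sup>2"
  using zero_le_power2[of "\<bar>x\<bar> - 1"] by (simp add: power2_diff)

text \<open>The derivative of \<open>ln (1 + x\<^sup>2)\<close>, which is the location score of the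
  density divided by \<open>m\<close>. Without that factor all pointwise bounds are free of
  \<open>m\<close>.\<close>

definition score :: "real \<Rightarrow> real" where
  "score x = 2 * x / (1 + x\<^sup>2)"

definition score_deriv :: "real \<Rightarrow> real" where
  "score_deriv x = 2 * (1 - x\<^sup>2) / (1 + x\<^sup>2)\<^sup>2"

lemma borel_measurable_score [measurable]:
  "score \<in> borel_measurable borel" "score_deriv \<in> borel_measurable borel"
  unfolding score_def[abs_def] score_deriv_def[abs_def] by measurable

lemma abs_score_le: "\<bar>score x\<bar> \<le> 1"
  using abs_le_one_plus_square[of x] one_plus_square_pos[of x]
  by (simp add: score_def abs_mult field_simps)

lemma abs_score_deriv_le: "\<bar>score_deriv x\<bar> \<le> 2"
proof -
  have "\<bar>1 - x\<^sup>2\<bar> \<le> 1 + x\<^sup>2" by (simp add: abs_le_iff)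
  also have "\<dots> \<le> (1 + x\<^sup>2)\<^sup>2"
    using self_le_power[of "1 + x\<^sup>2" 2] by simp
  finally show ?thesis
    using one_plus_square_pos[of x] by (simp add: score_deriv_def abs_mult divide_le_eq)
qed

lemma DERIV_ln_one_plus_square:
  "((\<lambda>x. ln (1 + x\<^sup>2)) has_real_derivative score x) (at x)"
  unfolding score_def using one_plus_square_pos[of x] by (auto intro!: derivative_eq_intros)

lemma DERIV_score: "(score has_real_derivative score_deriv x) (at x)"
  unfolding score_def[abs_def] score_deriv_def using one_plus_square_pos[of x]
  by (auto intro!: derivative_eq_intros simp: divide_simps power2_eq_square algebra_simps)

lemma DERIV_score_deriv:
  "(score_deriv has_real_derivative (4 * x^3 - 12 * x) / (1 + x\<^sup>2)^3) (at x)"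
proof -
  have nz: "1 + x\<^sup>2 \<noteq> 0" using one_plus_square_pos[of x] by simp
  have "(score_deriv has_real_derivative
    ((0 - 2 * (2 * x)) * (1 + x\<^sup>2)\<^sup>2 - 2 * (1 - x\<^sup>2) * (2 * (1 + x\<^sup>2) * (2 * x)))
      / ((1 + x\<^sup>2)\<^sup>2 * (1 + x\<^sup>2)\<^sup>2)) (at x)"
    unfolding score_deriv_def[abs_def] using nz by (auto intro!: derivative_eq_intros)
  also have "((0 - 2 * (2 * x)) * (1 + x\<^sup>2)\<^sup>2 - 2 * (1 - x\<^sup>2) * (2 * (1 + x\<^sup>2) * (2 * x)))
      / ((1 + x\<^sup>2)\<^sup>2 * (1 + x\<^sup>2)\<^sup>2) = (4 * x^3 - 12 * x) / (1 + x\<^sup>2)^3"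
    using nz by (simp add: divide_simps) algebra
  finally show ?thesis .
qed

text \<open>Mean value bound. The numerator of the second derivative of \<open>score\<close> factors
  as \<open>2 * (2 * z) * (z\<^sup>2 - 3)\<close>, where \<open>2 * \<bar>z\<bar>\<close> is at most
  \<open>1 + z\<^sup>2\<close> and the last factor is at most \<open>3 * (1 + z\<^sup>2)\<close> in
  absolute value.\<close>

lemma abs_score_deriv_diff_le: "\<bar>score_deriv x - score_deriv y\<bar> \<le> 6 * \<bar>x - y\<bar>"
proof -
  have "norm (score_deriv x - score_deriv y) \<le> 6 * norm (x - y)"
  proof (rule field_differentiable_bound[OF convex_UNIV])
    fix z :: real
    show "(score_deriv has_field_derivative (4 * z^3 - 12 * z) / (1 + z\<^sup>2)^3) (at z within UNIV)"
      using DERIV_score_deriv by simp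
    have "4 * z^3 - 12 * z = 2 * (2 * z) * (z\<^sup>2 - 3)"
      by algebra
    then have "\<bar>4 * z^3 - 12 * z\<bar> = 2 * (2 * \<bar>z\<bar>) * \<bar>z\<^sup>2 - 3\<bar>"
      by (simp only: abs_mult abs_numeral)
    also have "\<dots> \<le> 2 * (1 + z\<^sup>2) * (3 * (1 + z\<^sup>2))"
      by (intro mult_mono abs_le_one_plus_square order.refl) (auto simp: abs_le_iff)
    also have "\<dots> = 6 * (1 + z\<^sup>2)\<^sup>2"
      by algebra
    also have "\<dots> \<le> 6 * (1 + z\<^sup>2)^3"
      using power_increasing[of 2 3 "1 + z\<^sup>2"] by (intro mult_left_mono) auto
    finally show "norm ((4 * z^3 - 12 * z) / (1 + z\<^sup>2)^3) \<le> 6"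
      using one_plus_square_pos[of z] by (simp add: divide_le_eq)
  qed auto
  then show ?thesis by simp
qed

text \<open>First-order Taylor expansion with a remainder uniform in \<open>y\<close>. The
  derivative of the remainder is bounded by \<open>6 * \<bar>t\<bar>\<close> on the whole segment,
  so the constant is 6 rather than the sharper 3 that integration would give.\<close>

lemma abs_score_taylor:
  "\<bar>score (y - t) - score y + t * score_deriv y\<bar> \<le> 6 * t\<^sup>2"
proof -
  let ?g = "\<lambda>s. score (y - s) + s * score_deriv y"
  have "norm (?g t - ?g 0) \<le> (6 * \<bar>t\<bar>) * norm (t - 0)"
  proof (rule field_differentiable_bound[OF convex_closed_segment])
    fix s assume "s \<in> closed_segment 0 t"
    then have s: "\<bar>s\<bar> \<le> \<bar>t\<bar>" by (auto simp: closed_segment_eq_real_ivl split: if_splits)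
    have "(?g has_real_derivative (score_deriv (y - s) * (0 - 1) + score_deriv y)) (at s)"
      by (rule derivative_eq_intros DERIV_chain2[OF DERIV_score] refl | simp)+
    then show "(?g has_field_derivative (score_deriv y - score_deriv (y - s)))
        (at s within closed_segment 0 t)"
      by (auto intro: has_field_derivative_at_within)
    show "norm (score_deriv y - score_deriv (y - s)) \<le> 6 * \<bar>t\<bar>"
      using abs_score_deriv_diff_le[of y "y - s"] s by simp
  qed auto
  then show ?thesis
    by (simp add: power2_eq_square mult.assoc abs_mult_self_eq algebra_simps)
qed

lemma abs_ln_one_plus_square_diff_le:
  "\<bar>ln (1 + x\<^sup>2) - ln (1 + y\<^sup>2)\<bar> \<le> \<bar>x - (y::real)\<bar>"
proof -
  have "norm (ln (1 + x\<^sup>2) - ln (1 + y\<^sup>2)) \<le> 1 * norm (x - y)"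
    by (rule field_differentiable_bound[OF convex_UNIV, where f' = score])
       (use abs_score_le DERIV_ln_one_plus_square in auto)
  then show ?thesis by simp
qed

section \<open>The centred law as a probability measure, and its moments\<close>

abbreviation pvii_integral :: "real \<Rightarrow> real" where
  "pvii_integral k \<equiv> \<integral>x. (1 + x\<^sup>2) powr (- k) \<partial>lborel"

lemma pvii_integral_pos:
  assumes "m > 1/2" shows "pvii_integral m > 0"
proof -
  have "pvii_integral m \<ge> 0" by (intro integral_nonneg_AE) auto
  moreover have "pvii_integral m \<noteq> 0"
  proof
    assume "pvii_integral m = 0"
    then have "AE x::real in lborel. (1 + x\<^sup>2) powr (- m) = 0"
      by (subst (asm) integral_nonneg_eq_0_iff_AE) (use integrable_powr_one_plus_square assms in auto)
    moreover have "(1 + x\<^sup>2) powr (- m) \<noteq> 0" for x :: real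
      using one_plus_square_pos[of x] by simp
    ultimately have "AE x::real in lborel. False" by simp
    then show False by (simp add: AE_iff_measurable[OF _ refl])
  qed
  ultimately show ?thesis by linarith
qed

lemma pvii_const_pos: "m > 1/2 \<Longrightarrow> pvii_const m > 0"
  unfolding pvii_const_def using pvii_integral_pos by simp

lemma pvii_density_pos: "m > 1/2 \<Longrightarrow> pvii_density m x > 0"
  unfolding pvii_density_def using pvii_const_pos one_plus_square_pos[of x] by simp

lemma borel_measurable_pvii_density [measurable]: "pvii_density m \<in> borel_measurable borel"
  unfolding pvii_density_def[abs_def] by measurable

lemma sets_pvii_distribution [simp, measurable_cong]: "sets (pvii_distribution m \<theta>) = sets borel"
  by (simp add: pvii_distribution_def)

lemma space_pvii_distribution [simp]: "space (pvii_distribution m \<theta>) = UNIV"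
  by (simp add: pvii_distribution_def)

lemma integrable_pvii_density: "m > 1/2 \<Longrightarrow> integrable lborel (pvii_density m)"
  unfolding pvii_density_def[abs_def] by (intro integrable_mult_right integrable_powr_one_plus_square)

lemma integral_pvii_density: "m > 1/2 \<Longrightarrow> (\<integral>x. pvii_density m x \<partial>lborel) = 1"
  unfolding pvii_density_def[abs_def] pvii_const_def using pvii_integral_pos[of m] by simp

lemma integrable_pvii_iff:
  assumes "m > 1/2" and [measurable]: "g \<in> borel_measurable borel"
  shows "integrable (pvii_distribution m 0) g \<longleftrightarrow> integrable lborel (\<lambda>x. pvii_density m x * g x)"
  unfolding pvii_distribution_def using assms
  by (subst integrable_real_density) (auto intro!: less_imp_le pvii_density_pos)

lemma integral_pvii:
  assumes "m > 1/2" and [measurable]: "g \<in> borel_measurable borel"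
  shows "(\<integral>x. g x \<partial>pvii_distribution m 0) = (\<integral>x. pvii_density m x * g x \<partial>lborel)"
  unfolding pvii_distribution_def using assms
  by (subst integral_real_density) (auto intro!: less_imp_le pvii_density_pos)

lemma prob_space_pvii_distribution:
  assumes "m > 1/2" shows "prob_space (pvii_distribution m 0)"
proof (rule prob_spaceI)
  have "emeasure (pvii_distribution m 0) UNIV = (\<integral>\<^sup>+x. ennreal (pvii_density m x) \<partial>lborel)"
    by (simp add: pvii_distribution_def emeasure_density)
  also have "\<dots> = 1"
    using assms integrable_pvii_density integral_pvii_density
    by (subst nn_integral_eq_integral) (auto intro!: less_imp_le pvii_density_pos)
  finally show "emeasure (pvii_distribution m 0) (space (pvii_distribution m 0)) = 1" by simp
qed

lemma integrable_pvii_bounded: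
  fixes g :: "real \<Rightarrow> real"
  assumes "m > 1/2" "\<And>x. \<bar>g x\<bar> \<le> B" and [measurable]: "g \<in> borel_measurable borel"
  shows "integrable (pvii_distribution m 0) g"
proof -
  interpret prob_space "pvii_distribution m 0" using assms by (intro prob_space_pvii_distribution)
  show ?thesis using assms by (intro integrable_const_bound[of _ B]) auto
qed

text \<open>The density is even and \<open>score\<close> is odd, so reflection shows that the
  integral equals its own negative.\<close>

lemma expectation_score:
  assumes "m > 1/2" shows "(\<integral>x. score x \<partial>pvii_distribution m 0) = 0"
proof -
  let ?I = "\<integral>x. pvii_density m x * score x \<partial>lborel"
  have "?I = (\<integral>x. pvii_density m (- x) * score (- x) \<partial>lborel)"
    using lborel_integral_real_affine[of "-1" "\<lambda>x. pvii_density m x * score x" 0] by simp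
  also have "\<dots> = - ?I"
    by (simp add: pvii_density_def score_def)
  finally show ?thesis using assms by (simp add: integral_pvii)
qed

text \<open>Dividing the density by \<open>1 + x\<^sup>2\<close> raises the exponent from
  \<open>m\<close> to \<open>m + 1\<close>. The recurrence, used once or twice, leads back to the
  integral that \<open>pvii_const\<close> normalizes.\<close>

lemma pvii_moments:
  assumes m: "m > 1/2"
  shows "(\<integral>x. 1 / (1 + x\<^sup>2) \<partial>pvii_distribution m 0) = (2 * m - 1) / (2 * m)"
    and "(\<integral>x. 1 / (1 + x\<^sup>2)\<^sup>2 \<partial>pvii_distribution m 0) = (2 * m - 1) / (2 * m) * ((2 * m + 1) / (2 * m + 2))"
proof -
  have e1: "pvii_density m x * (1 / (1 + x\<^sup>2)) = pvii_const m * (1 + x\<^sup>2) powr (- (m + 1))" for x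
    using one_plus_square_pos[of x] powr_diff[of "1 + x\<^sup>2" "-m" 1]
    by (simp add: pvii_density_def)
  have e2: "pvii_density m x * (1 / (1 + x\<^sup>2)\<^sup>2) = pvii_const m * (1 + x\<^sup>2) powr (- (m + 1 + 1))" for x
    using one_plus_square_pos[of x] powr_diff[of "1 + x\<^sup>2" "-m" 2]
    by (simp add: pvii_density_def powr_numeral diff_diff_eq2 add.commute)
  have c: "pvii_const m * pvii_integral m = 1"
    using pvii_integral_pos[OF m] by (simp add: pvii_const_def)
  have r1: "pvii_integral (m + 1) = (2 * m - 1) / (2 * m) * pvii_integral m"
    using integral_powr_one_plus_square_recurrence[OF m] .
  have r2: "pvii_integral (m + 1 + 1) = (2 * m + 1) / (2 * m + 2) * pvii_integral (m + 1)"
    using integral_powr_one_plus_square_recurrence[of "m + 1"] m by simp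
  have "(\<integral>x. 1 / (1 + x\<^sup>2) \<partial>pvii_distribution m 0) = pvii_const m * pvii_integral (m + 1)"
    by (subst integral_pvii[OF m]) (simp_all only: e1 integral_mult_right_zero, measurable)
  also have "\<dots> = (2 * m - 1) / (2 * m) * (pvii_const m * pvii_integral m)"
    unfolding r1 by simp
  finally show "(\<integral>x. 1 / (1 + x\<^sup>2) \<partial>pvii_distribution m 0) = (2 * m - 1) / (2 * m)"
    using c by simp
  have "(\<integral>x. 1 / (1 + x\<^sup>2)\<^sup>2 \<partial>pvii_distribution m 0) = pvii_const m * pvii_integral (m + 1 + 1)"
    by (subst integral_pvii[OF m]) (simp_all only: e2 integral_mult_right_zero, measurable)
  also have "\<dots> = (2 * m + 1) / (2 * m + 2) * ((2 * m - 1) / (2 * m)) * (pvii_const m * pvii_integral m)"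
    unfolding r2 r1 by simp
  finally show "(\<integral>x. 1 / (1 + x\<^sup>2)\<^sup>2 \<partial>pvii_distribution m 0) =
      (2 * m - 1) / (2 * m) * ((2 * m + 1) / (2 * m + 2))"
    using c by (simp add: ac_simps)
qed

lemma integrable_pvii_inverse_powers:
  assumes m: "m > 1/2"
  shows "integrable (pvii_distribution m 0) (\<lambda>x. 1 / (1 + x\<^sup>2))"
    and "integrable (pvii_distribution m 0) (\<lambda>x. 1 / (1 + x\<^sup>2)\<^sup>2)"
  using one_plus_square_pos
  by (auto intro!: integrable_pvii_bounded[OF m, of _ 1] simp: divide_le_eq one_le_power less_imp_le)

lemma expectation_score_square:
  assumes m: "m > 1/2"
  shows "(\<integral>x. (score x)\<^sup>2 \<partial>pvii_distribution m 0) = (2 * m - 1) / (m * (m + 1))"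
proof -
  have "(score x)\<^sup>2 = 4 * (1 / (1 + x\<^sup>2)) - 4 * (1 / (1 + x\<^sup>2)\<^sup>2)" for x
    using one_plus_square_pos[of x]
    by (simp add: score_def divide_simps) (simp add: algebra_simps power2_eq_square)
  then have "(\<integral>x. (score x)\<^sup>2 \<partial>pvii_distribution m 0) =
      4 * ((2 * m - 1) / (2 * m)) - 4 * ((2 * m - 1) / (2 * m) * ((2 * m + 1) / (2 * m + 2)))"
    by (simp only: Bochner_Integration.integral_diff integrable_mult_right integral_mult_right_zero
        integrable_pvii_inverse_powers[OF m] pvii_moments[OF m])
  also have "\<dots> = (2 * m - 1) / (m * (m + 1))"
    using m by (simp add: divide_simps) (simp add: algebra_simps)
  finally show ?thesis .
qed

text \<open>Same reduction to inverse powers as for the second moment of \<open>score\<close>. The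
  value is \<open>m\<close> times that second moment, which is the Fisher information identity for
  the true score \<open>m * score\<close>.\<close>

lemma expectation_score_deriv:
  assumes m: "m > 1/2"
  shows "(\<integral>x. score_deriv x \<partial>pvii_distribution m 0) = (2 * m - 1) / (m + 1)"
proof -
  have "score_deriv x = 4 * (1 / (1 + x\<^sup>2)\<^sup>2) - 2 * (1 / (1 + x\<^sup>2))" for x
    using one_plus_square_pos[of x]
    by (simp add: score_deriv_def divide_simps) (simp add: algebra_simps power2_eq_square)
  then have "(\<integral>x. score_deriv x \<partial>pvii_distribution m 0) =
      4 * ((2 * m - 1) / (2 * m) * ((2 * m + 1) / (2 * m + 2))) - 2 * ((2 * m - 1) / (2 * m))"
    by (simp only: Bochner_Integration.integral_diff integrable_mult_right integral_mult_right_zero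
        integrable_pvii_inverse_powers[OF m] pvii_moments[OF m])
  also have "\<dots> = (2 * m - 1) / (m + 1)"
    using m by (simp add: divide_simps) (simp add: algebra_simps)
  finally show ?thesis .
qed

text \<open>The logarithm grows more slowly than any positive power. Square integrability is what
  the Chebyshev form of the weak law asks of functions involving the logarithmic loss.\<close>

lemma integrable_pvii_ln_square:
  assumes m: "m > 1/2"
  shows "integrable (pvii_distribution m 0) (\<lambda>x. (ln (1 + x\<^sup>2))\<^sup>2)"
proof -
  \<comment> \<open>The squared logarithm costs a factor
    \<open>(1 + x\<^sup>2) powr (2 * d)\<close>; this choice spends only half of the gap between
    \<open>m\<close> and 1/2.\<close>
  define d where "d = (m - 1/2) / 4"
  have d: "d > 0" "m - 2 * d > 1/2" using m by (auto simp: d_def field_simps)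
  have "integrable lborel (\<lambda>x. pvii_density m x * (ln (1 + x\<^sup>2))\<^sup>2)"
  proof (rule Bochner_Integration.integrable_bound)
    show "integrable lborel (\<lambda>x. pvii_const m / d\<^sup>2 * (1 + x\<^sup>2) powr (- (m - 2 * d)))"
      using d by (intro integrable_mult_right integrable_powr_one_plus_square)
    show "AE x in lborel. norm (pvii_density m x * (ln (1 + x\<^sup>2))\<^sup>2) \<le>
        norm (pvii_const m / d\<^sup>2 * (1 + x\<^sup>2) powr (- (m - 2 * d)))"
    proof (rule AE_I2)
      fix x :: real
      have "(ln (1 + x\<^sup>2))\<^sup>2 \<le> ((1 + x\<^sup>2) powr d / d)\<^sup>2"
        using d by (intro power_mono ln_powr_bound) auto
      also have "\<dots> = (1 + x\<^sup>2) powr (2 * d) / d\<^sup>2"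
        by (simp add: power_divide power2_eq_square flip: powr_add)
      finally have "pvii_density m x * (ln (1 + x\<^sup>2))\<^sup>2 \<le>
          pvii_density m x * ((1 + x\<^sup>2) powr (2 * d) / d\<^sup>2)"
        using pvii_density_pos[OF m, of x] by (intro mult_left_mono) auto
      also have "\<dots> = pvii_const m / d\<^sup>2 * (1 + x\<^sup>2) powr (- (m - 2 * d))"
        using powr_add[of "1 + x\<^sup>2" "-m" "2 * d"] by (simp add: pvii_density_def)
      finally show "norm (pvii_density m x * (ln (1 + x\<^sup>2))\<^sup>2) \<le>
        norm (pvii_const m / d\<^sup>2 * (1 + x\<^sup>2) powr (- (m - 2 * d)))"
        using pvii_density_pos[OF m, of x] pvii_const_pos[OF m] by simp
    qed
  qed auto
  then show ?thesis using m by (subst integrable_pvii_iff) auto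
qed

section \<open>The excess loss and its mean\<close>

text \<open>Subtracting the loss at the true location 0 leaves the minimizers unchanged and makes
  the function bounded in \<open>x\<close> for each fixed \<open>t\<close>.\<close>

definition excess :: "real \<Rightarrow> real \<Rightarrow> real" where
  "excess t x = ln (1 + (x - t)\<^sup>2) - ln (1 + x\<^sup>2)"

lemma borel_measurable_excess [measurable]: "excess t \<in> borel_measurable borel"
  unfolding excess_def[abs_def] by measurable

lemma abs_excess_le: "\<bar>excess t x\<bar> \<le> \<bar>t\<bar>"
  using abs_ln_one_plus_square_diff_le[of "x - t" x] by (simp add: excess_def)

lemma abs_excess_diff_le: "\<bar>excess s x - excess t x\<bar> \<le> \<bar>s - t\<bar>"
  using abs_ln_one_plus_square_diff_le[of "x - s" "x - t"] by (simp add: excess_def)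

lemma integrable_excess: "m > 1/2 \<Longrightarrow> integrable (pvii_distribution m 0) (excess t)"
  by (rule integrable_pvii_bounded[OF _ abs_excess_le]) auto

text \<open>Gibbs' inequality: up to the factor \<open>m\<close> this is the Kullback-Leibler divergence
  between the law and its translate by \<open>t\<close>.\<close>
lemma expectation_excess_pos:
  assumes m: "m > 1/2" and t: "t \<noteq> 0"
  shows "(\<integral>x. excess t x \<partial>pvii_distribution m 0) > 0"
proof -
  interpret prob_space "pvii_distribution m 0" using m by (rule prob_space_pvii_distribution)
  \<comment> \<open>The likelihood ratio of the translate to the law itself: it has mean 1, and its
    logarithm is \<open>- m * excess t x\<close>. The claim then comes from integrating
    \<open>ln r \<le> r - 1\<close>.\<close>
  define r where "r x = ((1 + (x - t)\<^sup>2) / (1 + x\<^sup>2)) powr (- m)" for x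
  have [measurable]: "r \<in> borel_measurable borel" unfolding r_def[abs_def] by measurable
  have rpos: "r x > 0" for x
    using one_plus_square_pos[of x] one_plus_square_pos[of "x - t"] by (simp add: r_def)
  have ln_r: "ln (r x) = - m * excess t x" for x
    using one_plus_square_pos[of x] one_plus_square_pos[of "x - t"]
    by (simp add: r_def excess_def ln_powr ln_div)
  have shift: "pvii_density m x * r x = pvii_density m (x - t)" for x
    using one_plus_square_pos[of x] one_plus_square_pos[of "x - t"]
    by (simp add: r_def pvii_density_def powr_divide)
  have "integrable lborel (\<lambda>x. pvii_density m (- t + 1 * x))"
    using integrable_pvii_density[OF m] by (intro lborel_integrable_real_affine) auto
  then have int_r: "integrable (pvii_distribution m 0) r"
    using m by (simp add: integrable_pvii_iff shift)
  have "(\<integral>x. pvii_density m (- t + 1 * x) \<partial>lborel) = 1"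
    using lborel_integral_real_affine[of 1 "pvii_density m" "-t"] integral_pvii_density[OF m] by simp
  then have E_r: "expectation r = 1"
    using m by (simp add: integral_pvii shift)
  \<comment> \<open>The two densities agree only at the midpoint \<open>t / 2\<close>, so the
    logarithmic inequality is strict almost everywhere.\<close>
  have "AE x in lborel. x \<noteq> t / 2" by (rule AE_lborel_singleton)
  then have "AE x in pvii_distribution m 0. x \<noteq> t / 2"
    unfolding pvii_distribution_def by (subst AE_density) auto
  then have "AE x in pvii_distribution m 0. - m * excess t x < r x - 1"
  proof eventually_elim
    case (elim x)
    have "x\<^sup>2 \<noteq> (x - t)\<^sup>2"
      using elim t by (auto simp: power2_eq_iff)
    then have "excess t x \<noteq> 0"
      using one_plus_square_pos[of x] one_plus_square_pos[of "x - t"]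
      by (auto simp: excess_def)
    then have "r x \<noteq> 1" using ln_r[of x] m by auto
    then show ?case
      using ln_le_minus_one[OF rpos[of x]] ln_eq_minus_one[OF rpos[of x]] ln_r[of x] by fastforce
  qed
  then have "expectation (\<lambda>x. - m * excess t x) < expectation (\<lambda>x. r x - 1)"
    using int_r integrable_excess[OF m]
    by (intro integral_less_AE_space) (auto simp: emeasure_space_1[simplified])
  then have "- m * expectation (excess t) < 0"
    using int_r E_r prob_space by simp
  then show ?thesis using m by (simp add: mult_less_0_iff zero_less_mult_iff)
qed

section \<open>Weak law of large numbers, continuous mapping and Slutsky's theorem\<close>

context prob_space
begin

text \<open>Measurability is built in because \<open>prob\<close> takes the default value 0 on
  non-measurable sets, where the limit alone would be meaningless.\<close>

definition vanishing :: "(nat \<Rightarrow> 'a \<Rightarrow> bool) \<Rightarrow> bool" where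
  "vanishing P \<longleftrightarrow> (\<forall>n. {\<omega> \<in> space M. P n \<omega>} \<in> events) \<and>
     (\<lambda>n. prob {\<omega> \<in> space M. P n \<omega>}) \<longlonglongrightarrow> 0"

lemma vanishing_mono:
  assumes Q: "vanishing Q" and P: "\<And>n. {\<omega> \<in> space M. P n \<omega>} \<in> events"
    and PQ: "\<And>n \<omega>. n > 0 \<Longrightarrow> \<omega> \<in> space M \<Longrightarrow> P n \<omega> \<Longrightarrow> Q n \<omega>"
  shows "vanishing P"
proof -
  have "(\<lambda>n. prob {\<omega> \<in> space M. P n \<omega>}) \<longlonglongrightarrow> 0"
  proof (rule tendsto_sandwich[OF _ _ tendsto_const])
    show "(\<lambda>n. prob {\<omega> \<in> space M. Q n \<omega>}) \<longlonglongrightarrow> 0" using Q by (simp add: vanishing_def)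
    show "eventually (\<lambda>n. prob {\<omega> \<in> space M. P n \<omega>} \<le> prob {\<omega> \<in> space M. Q n \<omega>}) sequentially"
      using eventually_gt_at_top[of 0]
    proof eventually_elim
      case (elim n)
      then show ?case using Q PQ by (intro finite_measure_mono) (auto simp: vanishing_def)
    qed
  qed auto
  then show ?thesis using P by (simp add: vanishing_def)
qed

lemma vanishing_disj:
  assumes "vanishing P" "vanishing Q"
  shows "vanishing (\<lambda>n \<omega>. P n \<omega> \<or> Q n \<omega>)"
proof -
  have meas: "{\<omega> \<in> space M. P n \<omega> \<or> Q n \<omega>} \<in> events" for n
    using assms by (auto simp: vanishing_def intro: sets.sets_Collect_disj)
  have "(\<lambda>n. prob {\<omega> \<in> space M. P n \<omega> \<or> Q n \<omega>}) \<longlonglongrightarrow> 0"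
  proof (rule tendsto_sandwich[OF _ _ tendsto_const])
    show "(\<lambda>n. prob {\<omega> \<in> space M. P n \<omega>} + prob {\<omega> \<in> space M. Q n \<omega>}) \<longlonglongrightarrow> 0"
      using assms tendsto_add[of _ 0 _ _ 0] by (auto simp: vanishing_def)
    have "prob {\<omega> \<in> space M. P n \<omega> \<or> Q n \<omega>} \<le>
        prob {\<omega> \<in> space M. P n \<omega>} + prob {\<omega> \<in> space M. Q n \<omega>}" for n
    proof -
      have "{\<omega> \<in> space M. P n \<omega> \<or> Q n \<omega>} = {\<omega> \<in> space M. P n \<omega>} \<union> {\<omega> \<in> space M. Q n \<omega>}" by auto
      then show ?thesis using assms by (auto simp: vanishing_def intro!: measure_Un_le)
    qed
    then show "eventually (\<lambda>n. prob {\<omega> \<in> space M. P n \<omega> \<or> Q n \<omega>} \<le>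
        prob {\<omega> \<in> space M. P n \<omega>} + prob {\<omega> \<in> space M. Q n \<omega>}) sequentially" by simp
  qed auto
  then show ?thesis using meas by (simp add: vanishing_def)
qed

lemma vanishing_finite_ex:
  assumes "finite F" "\<And>t. t \<in> F \<Longrightarrow> vanishing (P t)"
  shows "vanishing (\<lambda>n \<omega>. \<exists>t\<in>F. P t n \<omega>)"
  using assms
proof (induction F rule: finite_induct)
  case empty
  then show ?case by (simp add: vanishing_def)
next
  case (insert t F)
  then have "vanishing (\<lambda>n \<omega>. P t n \<omega> \<or> (\<exists>t\<in>F. P t n \<omega>))" by (intro vanishing_disj) auto
  then show ?case by simp
qed

text \<open>Allows exceptional events \<open>A\<close> whose probability is not small in the limit
  but is at most \<open>r\<close> for every \<open>n\<close>. This is how boundedness in probability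
  enters the linearization.\<close>

lemma vanishing_approx:
  assumes P: "\<And>n. {\<omega> \<in> space M. P n \<omega>} \<in> events"
    and approx: "\<And>r. r > 0 \<Longrightarrow> \<exists>Q A. vanishing Q \<and>
      (\<forall>n. {\<omega> \<in> space M. A n \<omega>} \<in> events \<and> prob {\<omega> \<in> space M. A n \<omega>} \<le> r) \<and>
      (\<forall>n>0. \<forall>\<omega>\<in>space M. P n \<omega> \<longrightarrow> Q n \<omega> \<or> A n \<omega>)"
  shows "vanishing P"
proof -
  have "(\<lambda>n. prob {\<omega> \<in> space M. P n \<omega>}) \<longlonglongrightarrow> 0"
  proof (rule LIMSEQ_I)
    fix r :: real assume r: "r > 0"
    from approx[OF half_gt_zero[OF r]] obtain Q A where Q: "vanishing Q"
      and A: "\<forall>n. {\<omega> \<in> space M. A n \<omega>} \<in> events \<and> prob {\<omega> \<in> space M. A n \<omega>} \<le> r / 2"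
      and PQA: "\<forall>n>0. \<forall>\<omega>\<in>space M. P n \<omega> \<longrightarrow> Q n \<omega> \<or> A n \<omega>"
      by blast
    have "(\<lambda>n. prob {\<omega> \<in> space M. Q n \<omega>}) \<longlonglongrightarrow> 0" using Q by (simp add: vanishing_def)
    then obtain N where N: "\<And>n. n \<ge> N \<Longrightarrow> prob {\<omega> \<in> space M. Q n \<omega>} < r / 2"
      using LIMSEQ_D[of "\<lambda>n. prob {\<omega> \<in> space M. Q n \<omega>}" 0 "r/2"] r by auto
    show "\<exists>N. \<forall>n\<ge>N. norm (prob {\<omega> \<in> space M. P n \<omega>} - 0) < r"
    proof (intro exI[of _ "Suc N"] allI impI)
      fix n assume n: "n \<ge> Suc N"
      have "prob {\<omega> \<in> space M. P n \<omega>} \<le> prob ({\<omega> \<in> space M. Q n \<omega>} \<union> {\<omega> \<in> space M. A n \<omega>})"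
        using n PQA[rule_format, of n] Q A by (intro finite_measure_mono) (auto simp: vanishing_def)
      also have "\<dots> \<le> prob {\<omega> \<in> space M. Q n \<omega>} + prob {\<omega> \<in> space M. A n \<omega>}"
        using Q A by (intro measure_Un_le) (auto simp: vanishing_def)
      also have "\<dots> < r" using N[of n] A[rule_format, of n] n by simp
      finally show "norm (prob {\<omega> \<in> space M. P n \<omega>} - 0) < r" by simp
    qed
  qed
  then show ?thesis using P by (simp add: vanishing_def)
qed

section \<open>Second moments of independent sums and the weak law\<close>

text \<open>Induction on \<open>n\<close>: the new summand is centred and independent of the partial
  sum, so the cross term has expectation 0.\<close>

lemma second_moment_sum:
  fixes Z :: "nat \<Rightarrow> 'a \<Rightarrow> real"
  assumes ind: "indep_vars (\<lambda>_. borel) Z UNIV"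
    and mean: "\<And>i. expectation (Z i) = 0"
    and sq: "\<And>i. integrable M (\<lambda>\<omega>. (Z i \<omega>)\<^sup>2)"
    and var: "\<And>i. expectation (\<lambda>\<omega>. (Z i \<omega>)\<^sup>2) = v"
  shows "integrable M (\<lambda>\<omega>. (\<Sum>i<n. Z i \<omega>)\<^sup>2)" (is "?int n")
    and "expectation (\<lambda>\<omega>. (\<Sum>i<n. Z i \<omega>)\<^sup>2) = n * v" (is "?E n")
proof -
  have [measurable]: "Z i \<in> borel_measurable M" for i
    using ind by (simp add: indep_vars_def2)
  have Zint: "integrable M (Z i)" for i
    by (rule square_integrable_imp_integrable[OF _ sq]) simp
  have "?int n \<and> ?E n"
  proof (induction n)
    case 0
    then show ?case by simp
  next
    case (Suc n)
    let ?S = "\<lambda>\<omega>. \<Sum>i<n. Z i \<omega>"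
    have "indep_var borel (Z n) borel ?S"
      by (rule indep_vars_sum) (auto intro: indep_vars_subset[OF ind])
    moreover have "integrable M ?S" using Zint by simp
    ultimately have p: "integrable M (\<lambda>\<omega>. Z n \<omega> * ?S \<omega>)" "expectation (\<lambda>\<omega>. Z n \<omega> * ?S \<omega>) = 0"
      using indep_var_integrable[of "Z n" ?S] indep_var_lebesgue_integral[of "Z n" ?S] Zint mean by auto
    have eq: "(\<Sum>i<Suc n. Z i \<omega>)\<^sup>2 = (?S \<omega>)\<^sup>2 + 2 * (Z n \<omega> * ?S \<omega>) + (Z n \<omega>)\<^sup>2" for \<omega>
      by (simp add: power2_sum algebra_simps)
    show ?case unfolding eq using Suc p sq var by (simp add: algebra_simps)
  qed
  then show "?int n" "?E n" by auto
qed

text \<open>Chebyshev's inequality. With \<open>a\<close> of order \<open>n\<close> it gives the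
  weak law; with \<open>a\<close> of order \<open>sqrt n\<close> it gives tightness of the
  normalized score sum.\<close>

lemma prob_abs_sum_ge:
  fixes Z :: "nat \<Rightarrow> 'a \<Rightarrow> real"
  assumes ind: "indep_vars (\<lambda>_. borel) Z UNIV"
    and mean: "\<And>i. expectation (Z i) = 0"
    and sq: "\<And>i. integrable M (\<lambda>\<omega>. (Z i \<omega>)\<^sup>2)"
    and var: "\<And>i. expectation (\<lambda>\<omega>. (Z i \<omega>)\<^sup>2) = v"
    and a: "a > 0"
  shows "prob {\<omega> \<in> space M. a \<le> \<bar>\<Sum>i<n. Z i \<omega>\<bar>} \<le> n * v / a\<^sup>2"
proof -
  have [measurable]: "Z i \<in> borel_measurable M" for i
    using ind by (simp add: indep_vars_def2)
  show ?thesis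
    using second_moment_method[of "\<lambda>\<omega>. \<Sum>i<n. Z i \<omega>" a] second_moment_sum[OF ind mean sq var, of n] a
    by simp
qed

end

locale iid_sample = prob_space M for M :: "'a measure" +
  fixes Y :: "nat \<Rightarrow> 'a \<Rightarrow> real" and \<mu> :: "real measure"
  assumes indep: "indep_vars (\<lambda>_. borel) Y UNIV"
    and law: "\<And>i. distr M borel (Y i) = \<mu>"
begin

lemma measurable_Y [measurable]: "Y i \<in> borel_measurable M"
  using indep by (simp add: indep_vars_def2)

lemma indep_compose: "g \<in> borel_measurable borel \<Longrightarrow> indep_vars (\<lambda>_. borel) (\<lambda>i \<omega>. g (Y i \<omega>)) UNIV"
  by (rule indep_vars_compose2[OF indep]) auto

lemma integrable_compose:
  fixes g :: "real \<Rightarrow> real"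
  assumes "g \<in> borel_measurable borel"
  shows "integrable M (\<lambda>\<omega>. g (Y i \<omega>)) \<longleftrightarrow> integrable \<mu> g"
  using assms law[of i] integrable_distr_eq[of "Y i" M borel g] by simp

lemma expectation_compose:
  fixes g :: "real \<Rightarrow> real"
  assumes "g \<in> borel_measurable borel"
  shows "expectation (\<lambda>\<omega>. g (Y i \<omega>)) = (\<integral>x. g x \<partial>\<mu>)"
  using assms law[of i] integral_distr[of "Y i" M borel g] by simp

lemma prob_space_law: "prob_space \<mu>"
  using prob_space_distr[OF measurable_Y[of 0]] by (simp add: law)

text \<open>Chebyshev's inequality for the centred function \<open>h\<close> with threshold
  \<open>n * e\<close> gives a bound of order \<open>1 / n\<close>. The event is multiplied through
  by \<open>n\<close>, which keeps it free of division.\<close>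

lemma weak_law_of_large_numbers:
  fixes g :: "real \<Rightarrow> real" and e :: real
  assumes g [measurable]: "g \<in> borel_measurable borel"
    and int: "integrable \<mu> (\<lambda>x. (g x)\<^sup>2)" and e: "e > 0"
  shows "vanishing (\<lambda>n \<omega>. n * e \<le> \<bar>(\<Sum>i<n. g (Y i \<omega>)) - n * (\<integral>x. g x \<partial>\<mu>)\<bar>)"
proof -
  interpret \<mu>: prob_space \<mu> by (rule prob_space_law)
  have sets_\<mu>: "sets \<mu> = sets borel" using law[of 0] by (metis sets_distr)
  have [measurable]: "g \<in> borel_measurable \<mu>" using g by (simp add: measurable_cong_sets[OF sets_\<mu>])
  have gint: "integrable \<mu> g"
    by (rule \<mu>.square_integrable_imp_integrable[OF _ int]) simp
  define h where "h x = g x - (\<integral>x. g x \<partial>\<mu>)" for x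
  have [measurable]: "h \<in> borel_measurable borel" unfolding h_def[abs_def] by measurable
  have h2: "integrable \<mu> (\<lambda>x. (h x)\<^sup>2)"
    using int gint by (simp add: h_def power2_diff)
  have h1: "(\<integral>x. h x \<partial>\<mu>) = 0" using gint by (simp add: h_def \<mu>.prob_space)
  define v where "v = (\<integral>x. (h x)\<^sup>2 \<partial>\<mu>)"
  have tail: "prob {\<omega> \<in> space M. a \<le> \<bar>\<Sum>i<n. h (Y i \<omega>)\<bar>} \<le> n * v / a\<^sup>2" if "a > 0" for a n
    using that h1 h2
    by (intro prob_abs_sum_ge) (auto simp: v_def expectation_compose[of h] expectation_compose[of "\<lambda>x. (h x)\<^sup>2"]
        integrable_compose[of "\<lambda>x. (h x)\<^sup>2"] intro!: indep_compose)
  have eq: "(\<Sum>i<n. g (Y i \<omega>)) - n * (\<integral>x. g x \<partial>\<mu>) = (\<Sum>i<n. h (Y i \<omega>))" for n \<omega>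
    by (simp add: h_def sum_subtractf)
  have "(\<lambda>n. prob {\<omega> \<in> space M. n * e \<le> \<bar>\<Sum>i<n. h (Y i \<omega>)\<bar>}) \<longlonglongrightarrow> 0"
  proof (rule tendsto_sandwich[OF _ _ tendsto_const])
    show "(\<lambda>n. v / e\<^sup>2 / real n) \<longlonglongrightarrow> 0" by real_asymp
    show "eventually (\<lambda>n. prob {\<omega> \<in> space M. n * e \<le> \<bar>\<Sum>i<n. h (Y i \<omega>)\<bar>} \<le> v / e\<^sup>2 / real n) sequentially"
      using eventually_gt_at_top[of 0]
    proof eventually_elim
      case (elim n)
      then show ?case using tail[of "n * e" n] e
        by (simp add: power_mult_distrib power2_eq_square field_simps)
    qed
  qed auto
  then show ?thesis by (simp add: vanishing_def eq)
qed

end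

section \<open>Tools for convergence in distribution\<close>

text \<open>The test functions \<open>cts_step\<close> determine weak convergence and are uniformly continuous.\<close>
lemma (in prob_space) weak_conv_m_Slutsky:
  assumes [measurable]: "\<And>n. Z n \<in> borel_measurable M" "\<And>n. W n \<in> borel_measurable M"
    and W: "weak_conv_m (\<lambda>n. distr M borel (W n)) \<mu>" and \<mu>: "real_distribution \<mu>"
    and diff: "\<And>e. e > 0 \<Longrightarrow> vanishing (\<lambda>n \<omega>. e \<le> \<bar>Z n \<omega> - W n \<omega>\<bar>)"
  shows "weak_conv_m (\<lambda>n. distr M borel (Z n)) \<mu>"
proof (rule integral_cts_step_conv_imp_weak_conv[OF _ \<mu>])
  show "real_distribution (distr M borel (Z n))" for n
    by (rule real_distribution_distr) simp
  fix x y :: real assume xy: "x < y"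
  let ?f = "cts_step x y"
  have uc: "uniformly_continuous_on UNIV ?f" using xy by (rule cts_step_uniformly_continuous)
  have f01: "0 \<le> ?f z" "?f z \<le> 1" for z using xy by (auto simp: cts_step_def)
  have [measurable]: "?f \<in> borel_measurable borel"
    using uc by (intro borel_measurable_continuous_onI uniformly_continuous_imp_continuous)
  have int: "integrable M (\<lambda>\<omega>. ?f (V \<omega>))" if [measurable]: "V \<in> borel_measurable M" for V
    by (rule integrable_const_bound[of _ 1]) (use f01 in \<open>auto intro!: AE_I2\<close>)
  have "(\<lambda>n. integral\<^sup>L (distr M borel (W n)) ?f) \<longlonglongrightarrow> integral\<^sup>L \<mu> ?f"
  proof (rule weak_conv_imp_integral_bdd_continuous_conv[OF _ \<mu> W])
    show "real_distribution (distr M borel (W n))" for n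
      by (rule real_distribution_distr) simp
    show "isCont ?f z" for z
      using uniformly_continuous_imp_continuous[OF uc] by (simp add: continuous_on_eq_continuous_at)
    show "norm (?f z) \<le> 1" for z using f01[of z] by simp
  qed
  then have limW: "(\<lambda>n. expectation (\<lambda>\<omega>. ?f (W n \<omega>))) \<longlonglongrightarrow> integral\<^sup>L \<mu> ?f"
    by (simp add: integral_distr)
  have "(\<lambda>n. expectation (\<lambda>\<omega>. ?f (Z n \<omega>)) - expectation (\<lambda>\<omega>. ?f (W n \<omega>))) \<longlonglongrightarrow> 0"
  proof (rule LIMSEQ_I)
    fix r :: real assume r: "r > 0"
    then obtain d where d: "d > 0" "\<And>u v. \<bar>u - v\<bar> < d \<Longrightarrow> \<bar>?f u - ?f v\<bar> < r / 2"
      using uc unfolding uniformly_continuous_on_def dist_real_def by (metis UNIV_I half_gt_zero)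
    let ?A = "\<lambda>n. {\<omega> \<in> space M. d \<le> \<bar>Z n \<omega> - W n \<omega>\<bar>}"
    have "(\<lambda>n. prob (?A n)) \<longlonglongrightarrow> 0" using diff[OF d(1)] by (simp add: vanishing_def)
    then obtain N where N: "\<And>n. n \<ge> N \<Longrightarrow> prob (?A n) < r / 2"
      using LIMSEQ_D[of "\<lambda>n. prob (?A n)" 0 "r/2"] r by auto
    show "\<exists>N. \<forall>n\<ge>N. norm (expectation (\<lambda>\<omega>. ?f (Z n \<omega>)) - expectation (\<lambda>\<omega>. ?f (W n \<omega>)) - 0) < r"
    proof (intro exI allI impI)
      fix n assume n: "n \<ge> N"
      have "\<bar>expectation (\<lambda>\<omega>. ?f (Z n \<omega>)) - expectation (\<lambda>\<omega>. ?f (W n \<omega>))\<bar> =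
          \<bar>expectation (\<lambda>\<omega>. ?f (Z n \<omega>) - ?f (W n \<omega>))\<bar>" using int by simp
      also have "\<dots> \<le> expectation (\<lambda>\<omega>. \<bar>?f (Z n \<omega>) - ?f (W n \<omega>)\<bar>)"
        by (rule integral_abs_bound)
      \<comment> \<open>Off \<open>?A n\<close> uniform continuity bounds the difference by
        \<open>r / 2\<close>; on \<open>?A n\<close> it is at most 1, since \<open>?f\<close> takes
        values in the unit interval.\<close>
      also have "\<dots> \<le> expectation (\<lambda>\<omega>. r / 2 + indicator (?A n) \<omega>)"
      proof (rule integral_mono)
        fix \<omega> assume \<omega>: "\<omega> \<in> space M"
        show "\<bar>?f (Z n \<omega>) - ?f (W n \<omega>)\<bar> \<le> r / 2 + indicator (?A n) \<omega>"
        proof (cases "\<omega> \<in> ?A n")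
          case True
          then have "indicator (?A n) \<omega> = (1::real)" by simp
          then show ?thesis using f01[of "Z n \<omega>"] f01[of "W n \<omega>"] r by linarith
        next
          case False
          then show ?thesis using d(2)[of "Z n \<omega>" "W n \<omega>"] \<omega> by (simp add: not_le less_imp_le)
        qed
      qed (use int in \<open>auto simp: less_top[symmetric]\<close>)
      also have "\<dots> = r / 2 + prob (?A n)"
        by (subst Bochner_Integration.integral_add) (auto simp: prob_space less_top[symmetric])
      finally show "norm (expectation (\<lambda>\<omega>. ?f (Z n \<omega>)) - expectation (\<lambda>\<omega>. ?f (W n \<omega>)) - 0) < r"
        using N[OF n] by simp
    qed
  qed
  from tendsto_add[OF this limW] show "(\<lambda>n. integral\<^sup>L (distr M borel (Z n)) ?f) \<longlonglongrightarrow> integral\<^sup>L \<mu> ?f"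
    by (simp add: integral_distr)
qed

text \<open>A bounded continuous test function composed with \<open>h\<close> is again bounded and
  continuous. It serves to rescale the central limit theorem.\<close>

lemma (in prob_space) weak_conv_m_continuous_mapping:
  fixes h :: "real \<Rightarrow> real"
  assumes V [measurable]: "\<And>n. V n \<in> borel_measurable M"
    and conv: "weak_conv_m (\<lambda>n. distr M borel (V n)) \<mu>" and \<mu>: "real_distribution \<mu>"
    and h: "\<And>x. isCont h x"
  shows "weak_conv_m (\<lambda>n. distr M borel (\<lambda>\<omega>. h (V n \<omega>))) (distr \<mu> borel h)"
proof -
  interpret \<mu>: real_distribution \<mu> by (rule \<mu>)
  have hm [measurable]: "h \<in> borel_measurable borel"
    using h by (intro borel_measurable_continuous_onI continuous_at_imp_continuous_on) auto
  show ?thesis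
  proof (rule integral_bdd_continuous_conv_imp_weak_conv)
    show "real_distribution (distr M borel (\<lambda>\<omega>. h (V n \<omega>)))" for n
      by (rule real_distribution_distr) simp
    show "real_distribution (distr \<mu> borel h)"
      by (rule \<mu>.real_distribution_distr) simp
    fix f :: "real \<Rightarrow> real" assume f: "\<And>x. isCont f x" "\<And>x. \<bar>f x\<bar> \<le> 1"
    have [measurable]: "f \<in> borel_measurable borel"
      using f by (intro borel_measurable_continuous_onI continuous_at_imp_continuous_on) auto
    have "(\<lambda>n. integral\<^sup>L (distr M borel (V n)) (\<lambda>x. f (h x))) \<longlonglongrightarrow> integral\<^sup>L \<mu> (\<lambda>x. f (h x))"
    proof (rule weak_conv_imp_integral_bdd_continuous_conv[OF _ \<mu> conv])
      show "real_distribution (distr M borel (V n))" for n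
        by (rule real_distribution_distr) simp
      show "isCont (\<lambda>x. f (h x)) x" for x using isCont_o2[OF h f(1)] .
      show "norm (f (h x)) \<le> 1" for x using f(2) by simp
    qed
    then show "(\<lambda>n. integral\<^sup>L (distr M borel (\<lambda>\<omega>. h (V n \<omega>))) f) \<longlonglongrightarrow> integral\<^sup>L (distr \<mu> borel h) f"
      by (simp add: integral_distr)
  qed
qed

lemma distr_std_normal_scale:
  assumes s: "s > 0"
  shows "distr std_normal_distribution borel (\<lambda>x. s * x) = normal_distribution 0 s"
proof -
  interpret prob_space std_normal_distribution
    by (rule prob_space_normal_density) simp
  have "distributed std_normal_distribution lborel (\<lambda>x. x) std_normal_density"
    by (simp add: distributed_def distr_id2)
  from normal_density_affine[OF this, of s 0] s
  have "distributed std_normal_distribution lborel (\<lambda>x. s * x) (normal_density 0 s)" by simp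
  then have "distr std_normal_distribution lborel (\<lambda>x. s * x) = normal_distribution 0 s"
    by (simp add: distributed_def normal_distribution_def)
  then show ?thesis by (simp cong: distr_cong)
qed

section \<open>Consistency and asymptotic normality of the estimator\<close>

text \<open>The centred problem: the true location is 0 and \<open>T n\<close> is the estimation
  error. The maximum likelihood property enters as minimization of the summed excess loss.\<close>

locale pvii_mle = iid_sample M Y "pvii_distribution m 0" for M :: "'a measure" and Y m +
  fixes T :: "nat \<Rightarrow> 'a \<Rightarrow> real"
  assumes m: "m > 1/2"
    and measurable_T [measurable]: "\<And>n. T n \<in> borel_measurable M"
    and minimizer: "\<And>n \<omega> t. \<omega> \<in> space M \<Longrightarrow>
      (\<Sum>i<n. excess (T n \<omega>) (Y i \<omega>)) \<le> (\<Sum>i<n. excess t (Y i \<omega>))"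
begin

abbreviation \<mu> where "\<mu> \<equiv> pvii_distribution m 0"

lemma sum_excess_nonpos:
  assumes "\<omega> \<in> space M" shows "(\<Sum>i<n. excess (T n \<omega>) (Y i \<omega>)) \<le> 0"
  using minimizer[OF assms, of n 0] by (simp add: excess_def)

text \<open>Far away from the true location, all the functions \<open>excess t\<close> are bounded below by a
  single function with positive expectation.\<close>
lemma T_eventually_bounded:
  obtains K where "K \<ge> e" "vanishing (\<lambda>n \<omega>. K \<le> \<bar>T n \<omega>\<bar>)"
proof -
  interpret \<mu>: prob_space \<mu> using m by (rule prob_space_pvii_distribution)
  define p where "p = \<mu>.prob {-1..1}"
  define l where "l = (\<integral>x. ln (1 + x\<^sup>2) \<partial>\<mu>)"
  have intl: "integrable \<mu> (\<lambda>x. ln (1 + x\<^sup>2))"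
    by (rule \<mu>.square_integrable_imp_integrable[OF _ integrable_pvii_ln_square[OF m]]) measurable
  have "p \<noteq> 0"
  proof
    assume "p = 0"
    then have "AE x in \<mu>. x \<notin> {-1..1}"
      unfolding p_def by (subst (asm) \<mu>.prob_eq_0) auto
    then have "AE x in lborel. x \<notin> {-1..1::real}"
      unfolding pvii_distribution_def using pvii_density_pos[OF m] by (subst (asm) AE_density) auto
    then have "{-1..1::real} \<in> null_sets lborel"
      by (subst AE_iff_null_sets) auto
    then show False by (simp add: null_sets_def)
  qed
  then have p: "p > 0" using measure_nonneg[of \<mu> "{-1..1}"] by (simp add: p_def less_le)
  \<comment> \<open>The exponential makes \<open>L\<close> at least
    \<open>(\<bar>l\<bar> + 1) / p\<close>, so that \<open>p * L - l\<close>, the mean of the lower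
    bound \<open>\<phi>\<close>, is positive. The bound \<open>K \<ge> e\<close> keeps the annulus
    in the consistency proof nonempty.\<close>
  define K where "K = max (max 1 e) (1 + exp ((\<bar>l\<bar> + 1) / p))"
  define L where "L = ln (1 + (K - 1)\<^sup>2)"
  have K: "K \<ge> 1" "K \<ge> e" by (auto simp: K_def)
  have Kx: "exp ((\<bar>l\<bar> + 1) / p) \<le> K - 1" by (simp add: K_def)
  have "1 \<le> exp ((\<bar>l\<bar> + 1) / p)" using p by simp
  then have "1 \<le> K - 1" using Kx by linarith
  then have "K - 1 \<le> (K - 1)\<^sup>2" by (rule self_le_power) simp
  then have "exp ((\<bar>l\<bar> + 1) / p) \<le> 1 + (K - 1)\<^sup>2" using Kx by linarith
  then have "(\<bar>l\<bar> + 1) / p \<le> L"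
    unfolding L_def by (subst ln_ge_iff) (auto simp: one_plus_square_pos)
  then have "\<bar>l\<bar> + 1 \<le> L * p" using p by (simp only: pos_divide_le_eq)
  then have pL: "p * L > l" by (simp add: mult.commute)
  \<comment> \<open>For \<open>x\<close> in \<open>{-1..1}\<close> and
    \<open>\<bar>t\<bar> \<ge> K\<close> the distance from \<open>x\<close> to \<open>t\<close> is
    at least \<open>K - 1\<close>, so the loss at \<open>t\<close> is at least \<open>L\<close>; for
    other \<open>x\<close> it is bounded below by 0.\<close>
  define \<phi> where "\<phi> x = indicator {-1..1} x * L - ln (1 + x\<^sup>2)" for x :: real
  have [measurable]: "\<phi> \<in> borel_measurable borel" unfolding \<phi>_def[abs_def] by measurable
  have \<phi>_le: "\<phi> x \<le> excess t x" if t: "K \<le> \<bar>t\<bar>" for t x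
  proof (cases "x \<in> {-1..1}")
    case True
    then have "K - 1 \<le> \<bar>x - t\<bar>" using t by auto
    then have "(K - 1)\<^sup>2 \<le> (x - t)\<^sup>2" using K by (simp add: abs_le_square_iff[symmetric])
    then show ?thesis using True one_plus_square_pos by (simp add: \<phi>_def L_def excess_def)
  next
    case False
    then show ?thesis by (simp add: \<phi>_def excess_def)
  qed
  have inti: "integrable \<mu> (\<lambda>x. indicator {-1..1} x * L :: real)"
    by (rule integrable_pvii_bounded[OF m, of _ "\<bar>L\<bar>"]) (auto simp: indicator_def)
  have E\<phi>: "(\<integral>x. \<phi> x \<partial>\<mu>) > 0"
    using intl inti pL by (simp add: \<phi>_def p_def l_def)
  have "integrable \<mu> (\<lambda>x. (\<phi> x)\<^sup>2)"
  proof (rule Bochner_Integration.integrable_bound)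
    show "integrable \<mu> (\<lambda>x. 2 * (L\<^sup>2 + (ln (1 + x\<^sup>2))\<^sup>2))"
      using integrable_pvii_ln_square[OF m] by simp
    have ab: "(a - b)\<^sup>2 \<le> 2 * (a\<^sup>2 + b\<^sup>2)" for a b :: real
      using zero_le_power2[of "a + b"] by (simp add: power2_sum power2_diff)
    have "(\<phi> x)\<^sup>2 \<le> 2 * (L\<^sup>2 + (ln (1 + x\<^sup>2))\<^sup>2)" for x
      using ab[of "indicator {-1..1} x * L" "ln (1 + x\<^sup>2)"] by (auto simp: \<phi>_def indicator_def split: if_splits)
    then show "AE x in \<mu>. norm ((\<phi> x)\<^sup>2) \<le> norm (2 * (L\<^sup>2 + (ln (1 + x\<^sup>2))\<^sup>2))" by simp
  qed measurable
  then have "vanishing (\<lambda>n \<omega>. n * (\<integral>x. \<phi> x \<partial>\<mu>) \<le> \<bar>(\<Sum>i<n. \<phi> (Y i \<omega>)) - n * (\<integral>x. \<phi> x \<partial>\<mu>)\<bar>)"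
    using E\<phi> by (intro weak_law_of_large_numbers) auto
  then have "vanishing (\<lambda>n \<omega>. K \<le> \<bar>T n \<omega>\<bar>)"
  proof (rule vanishing_mono)
    fix n \<omega> assume \<omega>: "\<omega> \<in> space M" and T: "K \<le> \<bar>T n \<omega>\<bar>"
    \<comment> \<open>A nonpositive sum of the \<open>\<phi>\<close> values misses its positive
      expectation by at least that expectation, which is the event of the weak law.\<close>
    have "(\<Sum>i<n. \<phi> (Y i \<omega>)) \<le> (\<Sum>i<n. excess (T n \<omega>) (Y i \<omega>))"
      by (intro sum_mono \<phi>_le T)
    also have "\<dots> \<le> 0" by (rule sum_excess_nonpos[OF \<omega>])
    finally show "n * (\<integral>x. \<phi> x \<partial>\<mu>) \<le> \<bar>(\<Sum>i<n. \<phi> (Y i \<omega>)) - n * (\<integral>x. \<phi> x \<partial>\<mu>)\<bar>"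
      by linarith
  qed measurable
  with K that show ?thesis by blast
qed

text \<open>The compact part of Wald's argument. On the annulus between \<open>e\<close> and
  \<open>K\<close> the mean excess is continuous and positive, hence bounded away from 0, and
  Lipschitz dependence on \<open>t\<close> reduces the weak law to a finite net.\<close>

lemma T_consistent:
  assumes e: "e > 0" shows "vanishing (\<lambda>n \<omega>. e \<le> \<bar>T n \<omega>\<bar>)"
proof -
  interpret \<mu>: prob_space \<mu> using m by (rule prob_space_pvii_distribution)
  obtain K where K: "K \<ge> e" "vanishing (\<lambda>n \<omega>. K \<le> \<bar>T n \<omega>\<bar>)" by (rule T_eventually_bounded)
  define D where "D t = (\<integral>x. excess t x \<partial>\<mu>)" for t
  have D_lip: "\<bar>D s - D t\<bar> \<le> 1 * \<bar>s - t\<bar>" for s t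
  proof -
    have "\<bar>D s - D t\<bar> = \<bar>\<integral>x. excess s x - excess t x \<partial>\<mu>\<bar>"
      using integrable_excess[OF m] by (simp add: D_def)
    also have "\<dots> \<le> (\<integral>x. \<bar>excess s x - excess t x\<bar> \<partial>\<mu>)" by (rule integral_abs_bound)
    also have "\<dots> \<le> (\<integral>x. \<bar>s - t\<bar> \<partial>\<mu>)"
      using integrable_excess[OF m] by (intro integral_mono abs_excess_diff_le) auto
    finally show ?thesis using \<mu>.prob_space by simp
  qed
  have "1-lipschitz_on UNIV D"
    using D_lip by (intro lipschitz_onI) (auto simp: dist_real_def)
  then have D_cont: "continuous_on A D" for A
    using lipschitz_on_continuous_on continuous_on_subset by blast
  define C where "C = cball (0::real) K - ball 0 e"
  have C: "compact C" unfolding C_def by (intro compact_diff compact_cball open_ball)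
  have C_iff: "t \<in> C \<longleftrightarrow> e \<le> \<bar>t\<bar> \<and> \<bar>t\<bar> \<le> K" for t by (auto simp: C_def dist_real_def)
  have "C \<noteq> {}" using C_iff[of e] e K by auto
  with continuous_attains_inf[OF C _ D_cont] obtain t0 where
    t0: "t0 \<in> C" "\<And>t. t \<in> C \<Longrightarrow> D t0 \<le> D t" by blast
  define \<delta> where "\<delta> = D t0"
  have \<delta>: "\<delta> > 0" using t0(1) e C_iff expectation_excess_pos[OF m, of t0] by (auto simp: \<delta>_def D_def)
  \<comment> \<open>If \<open>T n \<omega>\<close> lies within \<open>\<delta> / 4\<close> of a net
    point \<open>t\<close>, the excess sum at \<open>t\<close> is at most
    \<open>n * (\<delta> / 4)\<close>, while its expectation is at least
    \<open>n * \<delta>\<close>. The deviation therefore exceeds the threshold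
    \<open>n * (\<delta> / 2)\<close>.\<close>
  obtain F where F: "F \<subseteq> C" "finite F" "C \<subseteq> (\<Union>t\<in>F. ball t (\<delta> / 4))"
    by (rule compactE_image[OF C, of C "\<lambda>t. ball t (\<delta> / 4)"]) (use \<delta> in auto)
  have "vanishing (\<lambda>n \<omega>. n * (\<delta> / 2) \<le> \<bar>(\<Sum>i<n. excess t (Y i \<omega>)) - n * (\<integral>x. excess t x \<partial>\<mu>)\<bar>)" for t
  proof (rule weak_law_of_large_numbers)
    show "integrable \<mu> (\<lambda>x. (excess t x)\<^sup>2)"
      using abs_excess_le[of t] by (intro integrable_pvii_bounded[OF m, of _ "t\<^sup>2"]) (auto simp: abs_le_square_iff)
  qed (use \<delta> in auto)
  then have "vanishing (\<lambda>n \<omega>. \<exists>t\<in>F. n * (\<delta> / 2) \<le> \<bar>(\<Sum>i<n. excess t (Y i \<omega>)) - n * D t\<bar>)"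
    unfolding D_def by (intro vanishing_finite_ex F) auto
  from vanishing_disj[OF this K(2)] show ?thesis
  proof (rule vanishing_mono)
    fix n \<omega> assume \<omega>: "\<omega> \<in> space M" and T: "e \<le> \<bar>T n \<omega>\<bar>"
    show "(\<exists>t\<in>F. n * (\<delta> / 2) \<le> \<bar>(\<Sum>i<n. excess t (Y i \<omega>)) - n * D t\<bar>) \<or> K \<le> \<bar>T n \<omega>\<bar>"
    proof (cases "K \<le> \<bar>T n \<omega>\<bar>")
      case False
      then have "T n \<omega> \<in> C" using T C_iff by auto
      then obtain t where t: "t \<in> F" "\<bar>t - T n \<omega>\<bar> < \<delta> / 4" using F(3) by (auto simp: dist_real_def)
      have "(\<Sum>i<n. excess t (Y i \<omega>)) \<le> (\<Sum>i<n. excess (T n \<omega>) (Y i \<omega>) + \<delta> / 4)"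
      proof (rule sum_mono)
        fix i
        show "excess t (Y i \<omega>) \<le> excess (T n \<omega>) (Y i \<omega>) + \<delta> / 4"
          using abs_excess_diff_le[of t "Y i \<omega>" "T n \<omega>"] t(2) by linarith
      qed
      also have "\<dots> \<le> n * (\<delta> / 4)"
        using sum_excess_nonpos[OF \<omega>, of n] by (simp add: sum.distrib)
      also have "\<dots> \<le> n * (D t - \<delta> / 2)"
        using t0(2)[of t] t(1) F(1) \<delta> by (intro mult_left_mono) (auto simp: \<delta>_def)
      finally have "n * (\<delta> / 2) \<le> \<bar>(\<Sum>i<n. excess t (Y i \<omega>)) - n * D t\<bar>"
        unfolding right_diff_distrib by linarith
      then show ?thesis using t(1) by blast
    qed simp
  qed measurable
qed

section \<open>The score equation and asymptotic normality\<close>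

text \<open>First-order condition at a global minimum over the whole line; the radius 1 of the local
  minimum is therefore arbitrary.\<close>

lemma score_equation:
  assumes "\<omega> \<in> space M" shows "(\<Sum>i<n. score (Y i \<omega> - T n \<omega>)) = 0"
proof -
  have "((\<lambda>t. \<Sum>i<n. excess t (Y i \<omega>)) has_real_derivative (\<Sum>i<n. - score (Y i \<omega> - T n \<omega>))) (at (T n \<omega>))"
    unfolding excess_def
    by (rule derivative_eq_intros DERIV_chain2[OF DERIV_ln_one_plus_square] refl | simp)+
  then have "(\<Sum>i<n. - score (Y i \<omega> - T n \<omega>)) = 0"
    by (rule DERIV_local_min[of _ _ _ 1]) (use minimizer[OF assms] in auto)
  then show ?thesis by (simp add: sum_negf)
qed

definition S :: "nat \<Rightarrow> 'a \<Rightarrow> real" where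
  "S n \<omega> = (\<Sum>i<n. score (Y i \<omega>))"

text \<open>The mean of \<open>score_deriv\<close>, equal to the Fisher information for location
  divided by \<open>m\<close>.\<close>

definition J :: real where "J = (2 * m - 1) / (m + 1)"

text \<open>The variance of \<open>score\<close>, equal to the Fisher information divided by
  \<open>m\<^sup>2\<close>.\<close>

definition v :: real where "v = (2 * m - 1) / (m * (m + 1))"

lemma measurable_S [measurable]: "S n \<in> borel_measurable M"
  unfolding S_def[abs_def] by measurable

lemma J_pos: "J > 0" and v_pos: "v > 0"
  using m by (auto simp: J_def v_def)

lemma integrable_score_square: "integrable \<mu> (\<lambda>x. (score x)\<^sup>2)"
  using abs_score_le by (intro integrable_pvii_bounded[OF m, of _ 1]) (auto simp: abs_square_le_1)

lemma score_sample_moments: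
  "expectation (\<lambda>\<omega>. score (Y i \<omega>)) = 0"
  "integrable M (\<lambda>\<omega>. (score (Y i \<omega>))\<^sup>2)"
  "expectation (\<lambda>\<omega>. (score (Y i \<omega>))\<^sup>2) = v"
  using expectation_compose[of score i] expectation_compose[of "\<lambda>x. (score x)\<^sup>2" i]
    integrable_compose[of "\<lambda>x. (score x)\<^sup>2" i] integrable_score_square
    expectation_score[OF m] expectation_score_square[OF m]
  by (auto simp: v_def)

lemma prob_S_ge: "a > 0 \<Longrightarrow> prob {\<omega> \<in> space M. a \<le> \<bar>S n \<omega>\<bar>} \<le> n * v / a\<^sup>2"
  unfolding S_def by (intro prob_abs_sum_ge indep_compose score_sample_moments) auto

text \<open>Each summand of the score equation is expanded around \<open>Y i \<omega>\<close>; since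
  those summands add up to 0, only the Taylor remainders survive.\<close>

lemma S_expansion:
  assumes \<omega>: "\<omega> \<in> space M"
  shows "\<bar>S n \<omega> - T n \<omega> * (\<Sum>i<n. score_deriv (Y i \<omega>))\<bar> \<le> 6 * n * (T n \<omega>)\<^sup>2"
proof -
  let ?t = "T n \<omega>"
  have "\<bar>S n \<omega> - ?t * (\<Sum>i<n. score_deriv (Y i \<omega>))\<bar> =
      \<bar>\<Sum>i<n. score (Y i \<omega> - ?t) - score (Y i \<omega>) + ?t * score_deriv (Y i \<omega>)\<bar>"
    using score_equation[OF \<omega>, of n]
    by (simp add: S_def sum.distrib sum_subtractf sum_distrib_left)
  also have "\<dots> \<le> (\<Sum>i<n. 6 * ?t\<^sup>2)"
    by (rule sum_abs[THEN order_trans]) (intro sum_mono abs_score_taylor)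
  finally show ?thesis by simp
qed

text \<open>By the weak law the sum of \<open>score_deriv\<close> is close to \<open>n * J\<close>,
  and by consistency \<open>T n\<close> is small, so \<open>S n\<close> differs from
  \<open>n * T n * J\<close> by a small multiple of \<open>n * \<bar>T n\<bar>\<close>. This forces
  \<open>n * \<bar>T n\<bar>\<close> to be at most of the order of \<open>\<bar>S n\<bar>\<close>,
  that is \<open>sqrt n\<close>, and the error is negligible after dividing by
  \<open>sqrt n\<close>.\<close>

lemma linearization:
  assumes e: "e > 0"
  shows "vanishing (\<lambda>n \<omega>. e \<le> \<bar>sqrt n * T n \<omega> - S n \<omega> / (sqrt n * J)\<bar>)"
proof (rule vanishing_approx)
  show "{\<omega> \<in> space M. e \<le> \<bar>sqrt n * T n \<omega> - S n \<omega> / (sqrt n * J)\<bar>} \<in> events" for n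
    by measurable
next
  fix r :: real assume r: "r > 0"
  \<comment> \<open>Makes the Chebyshev bound \<open>v / a\<^sup>2\<close> for the score sum equal
    to \<open>r\<close>.\<close>
  define a where "a = sqrt (v / r)"
  have a: "a > 0" "v / a\<^sup>2 \<le> r" using v_pos r by (auto simp: a_def)
  \<comment> \<open>The first bound gives \<open>7 * \<eta> \<le> J / 2\<close>, which absorbs the
    error term in the estimate of \<open>n * \<bar>T n\<bar>\<close>; the second brings the final
    error below \<open>e\<close>.\<close>
  define \<eta> where "\<eta> = min (J / 14) (e * J\<^sup>2 / (14 * a))"
  have "\<eta> > 0" using J_pos a e by (simp add: \<eta>_def)
  moreover have "\<eta> \<le> J / 14" and "\<eta> \<le> e * J\<^sup>2 / (14 * a)" by (auto simp: \<eta>_def)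
  ultimately have \<eta>: "\<eta> > 0" "14 * \<eta> \<le> J" "14 * \<eta> * a \<le> e * J\<^sup>2"
    using a by (simp_all add: pos_le_divide_eq mult_ac)
  let ?Q = "\<lambda>n \<omega>. n * \<eta> \<le> \<bar>(\<Sum>i<n. score_deriv (Y i \<omega>)) - n * J\<bar> \<or> \<eta> \<le> \<bar>T n \<omega>\<bar>"
  \<comment> \<open>At \<open>n = 0\<close> both sides of the inequality are 0, so without the first
    conjunct the event would be the whole space.\<close>
  let ?A = "\<lambda>n \<omega>. n > 0 \<and> a * sqrt n \<le> \<bar>S n \<omega>\<bar>"
  have "vanishing (\<lambda>n \<omega>. n * \<eta> \<le> \<bar>(\<Sum>i<n. score_deriv (Y i \<omega>)) - n * (\<integral>x. score_deriv x \<partial>\<mu>)\<bar>)"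
  proof (rule weak_law_of_large_numbers)
    have "(score_deriv x)\<^sup>2 \<le> 4" for x
      using abs_score_deriv_le[of x] abs_le_square_iff[of "score_deriv x" 2] by simp
    then show "integrable \<mu> (\<lambda>x. (score_deriv x)\<^sup>2)"
      by (intro integrable_pvii_bounded[OF m, of _ 4]) auto
  qed (use \<eta> in auto)
  then have "vanishing (\<lambda>n \<omega>. n * \<eta> \<le> \<bar>(\<Sum>i<n. score_deriv (Y i \<omega>)) - n * J\<bar>)"
    by (simp add: expectation_score_deriv[OF m] J_def)
  then have "vanishing ?Q" using T_consistent[OF \<eta>(1)] by (rule vanishing_disj)
  moreover have "\<forall>n. {\<omega> \<in> space M. ?A n \<omega>} \<in> events \<and> prob {\<omega> \<in> space M. ?A n \<omega>} \<le> r"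
  proof
    fix n
    show "{\<omega> \<in> space M. ?A n \<omega>} \<in> events \<and> prob {\<omega> \<in> space M. ?A n \<omega>} \<le> r"
    proof (cases "n = 0")
      case False
      then have "prob {\<omega> \<in> space M. ?A n \<omega>} \<le> n * v / (a * sqrt n)\<^sup>2"
        using prob_S_ge[of "a * sqrt n" n] a by simp
      also have "\<dots> = v / a\<^sup>2" using False by (simp add: power_mult_distrib)
      finally show ?thesis using a by simp
    qed (use r in simp)
  qed
  moreover have "\<forall>n>0. \<forall>\<omega>\<in>space M. e \<le> \<bar>sqrt n * T n \<omega> - S n \<omega> / (sqrt n * J)\<bar> \<longrightarrow> ?Q n \<omega> \<or> ?A n \<omega>"
  proof (intro allI impI ballI, rule ccontr)
    fix n :: nat and \<omega> assume n: "n > 0" and \<omega>: "\<omega> \<in> space M"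
      and ge: "e \<le> \<bar>sqrt n * T n \<omega> - S n \<omega> / (sqrt n * J)\<bar>" and not: "\<not> (?Q n \<omega> \<or> ?A n \<omega>)"
    let ?t = "T n \<omega>" and ?s = "S n \<omega>" and ?B = "\<Sum>i<n. score_deriv (Y i \<omega>)"
    have Q: "\<bar>?B - n * J\<bar> \<le> n * \<eta>" "\<bar>?t\<bar> \<le> \<eta>" and A: "\<bar>?s\<bar> < a * sqrt n"
      using not n by auto
    have "\<bar>?s - n * ?t * J\<bar> = \<bar>(?s - ?t * ?B) + ?t * (?B - n * J)\<bar>"
      by (simp add: algebra_simps)
    also have "\<dots> \<le> \<bar>?s - ?t * ?B\<bar> + \<bar>?t * (?B - n * J)\<bar>" by (rule abs_triangle_ineq)
    also have "\<dots> \<le> 6 * n * ?t\<^sup>2 + \<bar>?t\<bar> * (n * \<eta>)"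
      using S_expansion[OF \<omega>, of n] Q(1) by (intro add_mono) (auto simp: abs_mult intro: mult_left_mono)
    also have "6 * n * ?t\<^sup>2 = 6 * n * (\<bar>?t\<bar> * \<bar>?t\<bar>)" by (simp add: power2_eq_square)
    also have "\<dots> \<le> 6 * n * (\<bar>?t\<bar> * \<eta>)"
      using Q(2) by (intro mult_left_mono) auto
    \<comment> \<open>The 7 is 6 from the Taylor remainder, with one factor
      \<open>\<bar>?t\<bar>\<close> replaced by \<open>\<eta>\<close>, plus 1 from the weak
      law.\<close>
    finally have main: "\<bar>?s - n * ?t * J\<bar> \<le> 7 * \<eta> * (n * \<bar>?t\<bar>)" by (simp add: algebra_simps)
    \<comment> \<open>The error is at most half of the left-hand side, so it can be moved there;
      this is where the order of \<open>n * \<bar>?t\<bar>\<close> is obtained.\<close>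
    have "n * \<bar>?t\<bar> * J = \<bar>n * ?t * J\<bar>" using J_pos by (simp add: abs_mult)
    also have "\<dots> \<le> \<bar>?s\<bar> + 7 * \<eta> * (n * \<bar>?t\<bar>)" using main by linarith
    also have "7 * \<eta> * (n * \<bar>?t\<bar>) \<le> J / 2 * (n * \<bar>?t\<bar>)"
      using \<eta>(2) by (intro mult_right_mono) auto
    finally have nt: "n * \<bar>?t\<bar> * J \<le> 2 * \<bar>?s\<bar>" by (simp add: algebra_simps)
    have "\<bar>?s - n * ?t * J\<bar> * J \<le> 7 * \<eta> * (n * \<bar>?t\<bar>) * J"
      using main J_pos by (intro mult_right_mono) auto
    also have "\<dots> = 7 * \<eta> * (n * \<bar>?t\<bar> * J)" by simp
    also have "\<dots> \<le> 7 * \<eta> * (2 * \<bar>?s\<bar>)" using nt \<eta>(1) by (intro mult_left_mono) auto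
    also have "\<dots> < 7 * \<eta> * (2 * (a * sqrt n))" using A \<eta>(1) by simp
    also have "\<dots> = 14 * \<eta> * a * sqrt n" by simp
    also have "\<dots> \<le> e * J\<^sup>2 * sqrt n" using \<eta>(3) by (intro mult_right_mono) auto
    finally have lt: "\<bar>?s - n * ?t * J\<bar> * J < e * J\<^sup>2 * sqrt n" .
    have "sqrt n * ?t - ?s / (sqrt n * J) = - (?s - n * ?t * J) / (sqrt n * J)"
      using n J_pos by (simp add: field_simps)
    then have "\<bar>sqrt n * ?t - ?s / (sqrt n * J)\<bar> = \<bar>?s - n * ?t * J\<bar> / (sqrt n * J)"
      using J_pos by (simp add: abs_mult abs_minus_commute)
    also have "\<dots> = (\<bar>?s - n * ?t * J\<bar> * J) / (J\<^sup>2 * sqrt n)"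
      using J_pos by (simp add: power2_eq_square)
    also have "\<dots> < e" using lt n J_pos by (simp add: divide_less_eq mult.assoc)
    finally show False using ge by simp
  qed
  ultimately show "\<exists>Q A. vanishing Q \<and>
      (\<forall>n. {\<omega> \<in> space M. A n \<omega>} \<in> events \<and> prob {\<omega> \<in> space M. A n \<omega>} \<le> r) \<and>
      (\<forall>n>0. \<forall>\<omega>\<in>space M. e \<le> \<bar>sqrt n * T n \<omega> - S n \<omega> / (sqrt n * J)\<bar> \<longrightarrow> Q n \<omega> \<or> A n \<omega>)"
    by (intro exI[of _ ?Q] exI[of _ ?A] conjI)
qed

text \<open>The central limit theorem for \<open>S n / sqrt (n * v)\<close>, rescaled by
  \<open>sqrt v / J\<close>, gives a normal limit with variance \<open>v / J\<^sup>2\<close>.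
  Slutsky's theorem carries it over to the estimation error through the linearization.\<close>

lemma T_asymptotically_normal:
  "weak_conv_m (\<lambda>n. distr M borel (\<lambda>\<omega>. sqrt n * T n \<omega>))
    (normal_distribution 0 (sqrt ((m + 1) / (m * (2 * m - 1)))))"
proof -
  define s where "s = sqrt v / J"
  have s: "s > 0" using v_pos J_pos by (simp add: s_def)
  \<comment> \<open>With \<open>k = 2 * m - 1\<close> and \<open>q = m + 1\<close> the left-hand
    side is \<open>v / J\<^sup>2\<close>; abstract letters keep the factors from being multiplied
    out.\<close>
  have "k / (m * q) / (k / q)\<^sup>2 = q / (m * k)" if "k > 0" "q > 0" for k q :: real
    using that m by (simp add: field_simps power2_eq_square)
  from this[of "2 * m - 1" "m + 1"] have "s\<^sup>2 = (m + 1) / (m * (2 * m - 1))"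
    using m v_pos by (simp add: s_def power_divide) (simp add: v_def J_def power_divide)
  then have s_eq: "s = sqrt ((m + 1) / (m * (2 * m - 1)))" using s real_sqrt_unique by fastforce
  have "weak_conv_m (\<lambda>n. distr M borel (\<lambda>\<omega>. S n \<omega> / sqrt (n * (sqrt v)\<^sup>2))) std_normal_distribution"
    unfolding S_def
  proof (rule central_limit_theorem_zero_mean)
    show "distr M borel (\<lambda>\<omega>. score (Y n \<omega>)) = distr \<mu> borel score" for n
      using law[of n] distr_distr[of score borel borel "Y n" M] by (simp add: comp_def)
  qed (use v_pos score_sample_moments in \<open>auto intro: indep_compose\<close>)
  then have "weak_conv_m (\<lambda>n. distr M borel (\<lambda>\<omega>. s * (S n \<omega> / sqrt (n * (sqrt v)\<^sup>2))))
      (distr std_normal_distribution borel (\<lambda>x. s * x))"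
    by (intro weak_conv_m_continuous_mapping real_dist_normal_dist) auto
  moreover have "s * (S n \<omega> / sqrt (n * (sqrt v)\<^sup>2)) = S n \<omega> / (sqrt n * J)" for n \<omega>
    using v_pos by (simp add: s_def real_sqrt_mult)
  ultimately have "weak_conv_m (\<lambda>n. distr M borel (\<lambda>\<omega>. S n \<omega> / (sqrt n * J))) (normal_distribution 0 s)"
    using distr_std_normal_scale[OF s] by simp
  moreover have "real_distribution (normal_distribution 0 s)"
    unfolding distr_std_normal_scale[OF s, symmetric]
    by (intro prob_space.real_distribution_distr prob_space_normal_density) auto
  ultimately show ?thesis
    unfolding s_eq[symmetric]
  proof (rule weak_conv_m_Slutsky[rotated 2])
    show "(\<lambda>\<omega>. sqrt n * T n \<omega>) \<in> borel_measurable M"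
      "(\<lambda>\<omega>. S n \<omega> / (sqrt n * J)) \<in> borel_measurable M" for n
      by measurable
  qed (rule linearization)
qed

end

section \<open>Reduction to the centred problem\<close>

text \<open>Translation invariance of Lebesgue measure.\<close>

lemma distr_pvii_shift:
  "distr (pvii_distribution m \<theta>) borel (\<lambda>x. x - \<theta>) = pvii_distribution m 0"
proof (rule measure_eqI)
  fix A assume "A \<in> sets (distr (pvii_distribution m \<theta>) borel (\<lambda>x. x - \<theta>))"
  then have [measurable]: "A \<in> sets borel" by simp
  have "emeasure (distr (pvii_distribution m \<theta>) borel (\<lambda>x. x - \<theta>)) A =
      (\<integral>\<^sup>+x. ennreal (pvii_density m (x - \<theta>)) * indicator A (x - \<theta>) \<partial>lborel)"
    using measurable_sets_borel[of "\<lambda>x. x - \<theta>" borel A]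
    by (simp add: emeasure_distr pvii_distribution_def emeasure_density indicator_vimage)
  also have "\<dots> = (\<integral>\<^sup>+x. ennreal (pvii_density m x) * indicator A x \<partial>lborel)"
    by (subst nn_integral_real_affine[of _ 1 \<theta>]) auto
  also have "\<dots> = emeasure (pvii_distribution m 0) A"
    by (simp add: pvii_distribution_def emeasure_density)
  finally show "emeasure (distr (pvii_distribution m \<theta>) borel (\<lambda>x. x - \<theta>)) A =
      emeasure (pvii_distribution m 0) A" .
qed simp

text \<open>The log-likelihood is a constant minus \<open>m\<close> times the summed loss, so
  maximizing the likelihood is minimizing that sum.\<close>

lemma ln_prod_pvii_density:
  assumes m: "m > 1/2"
  shows "ln (\<Prod>i<n. pvii_density m (y i)) = n * ln (pvii_const m) - m * (\<Sum>i<(n::nat). ln (1 + (y i)\<^sup>2))"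
proof -
  have "ln (pvii_density m z) = ln (pvii_const m) - m * ln (1 + z\<^sup>2)" for z
    using pvii_const_pos[OF m] one_plus_square_pos[of z]
    by (simp add: pvii_density_def ln_mult ln_powr)
  then show ?thesis
    using pvii_density_pos[OF m] by (simp add: ln_prod less_imp_neq[symmetric] sum_subtractf sum_distrib_left)
qed

text \<open>\<open>normal_distribution\<close> takes the standard deviation as its second argument,
  hence the square root of the asymptotic variance.\<close>

theorem theorem1p2:
  fixes M :: "'a measure" and m \<theta> :: real
    and X :: "nat \<Rightarrow> 'a \<Rightarrow> real"
    and est :: "nat \<Rightarrow> (nat \<Rightarrow> real) \<Rightarrow> real"
  assumes "m > 1/2"
    and "prob_space M"
    and "prob_space.indep_vars M (\<lambda>i. borel) X UNIV"
    and "\<And>i. distr M borel (X i) = pvii_distribution m \<theta>"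
    and "\<And>n. est n \<in> borel_measurable (PiM {..<n} (\<lambda>_. borel))"
    and "\<And>n x t. x \<in> space (PiM {..<n} (\<lambda>_. (borel :: real measure))) \<Longrightarrow>
           (\<Prod>i<n. pvii_density m (x i - t)) \<le> (\<Prod>i<n. pvii_density m (x i - est n x))"
  shows "weak_conv_m
           (\<lambda>n. distr M borel (\<lambda>\<omega>. sqrt (real n) * (est n (\<lambda>i\<in>{..<n}. X i \<omega>) - \<theta>)))
           (normal_distribution 0 (sqrt ((m + 1) / (m * (2 * m - 1)))))"
proof -
  interpret prob_space M by fact
  note m = assms(1)
  have X [measurable]: "X i \<in> borel_measurable M" for i
    using assms(3) by (simp add: indep_vars_def2)
  note [measurable] = assms(5)
  define Y where "Y i \<omega> = X i \<omega> - \<theta>" for i \<omega>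
  define x where "x n \<omega> = (\<lambda>i\<in>{..<n}. X i \<omega>)" for n :: nat and \<omega>
  define T where "T n \<omega> = est n (x n \<omega>) - \<theta>" for n \<omega>
  have [measurable]: "x n \<in> M \<rightarrow>\<^sub>M PiM {..<n} (\<lambda>_. borel)" for n
    unfolding x_def[abs_def] by measurable
  interpret pvii_mle M Y m T
  proof unfold_locales
    show "indep_vars (\<lambda>_. borel) Y UNIV"
      unfolding Y_def[abs_def] by (rule indep_vars_compose2[OF assms(3)]) auto
    show "distr M borel (Y i) = pvii_distribution m 0" for i
      using distr_distr[of "\<lambda>x. x - \<theta>" borel borel "X i" M] distr_pvii_shift[of m \<theta>]
      by (simp add: assms(4) Y_def[abs_def] comp_def)
    show "m > 1/2" by (rule m)
    show "T n \<in> borel_measurable M" for n unfolding T_def[abs_def] by measurable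
    fix n \<omega> t assume "\<omega> \<in> space M"
    then have "x n \<omega> \<in> space (PiM {..<n} (\<lambda>_. borel))" by (rule measurable_space[rotated]) measurable
    \<comment> \<open>The competitor is shifted by \<open>\<theta>\<close> so that \<open>t\<close>
      measures the deviation from the true location, as \<open>T n\<close> does.\<close>
    from assms(6)[OF this, of "\<theta> + t"]
    have "(\<Prod>i<n. pvii_density m (x n \<omega> i - (\<theta> + t))) \<le> (\<Prod>i<n. pvii_density m (x n \<omega> i - est n (x n \<omega>)))" .
    moreover have "x n \<omega> i - (\<theta> + t) = Y i \<omega> - t" "x n \<omega> i - est n (x n \<omega>) = Y i \<omega> - T n \<omega>" if "i < n" for i
      using that by (simp_all add: Y_def T_def) (simp_all add: x_def)
    ultimately have "(\<Prod>i<n. pvii_density m (Y i \<omega> - t)) \<le> (\<Prod>i<n. pvii_density m (Y i \<omega> - T n \<omega>))"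
      by simp
    \<comment> \<open>After taking logarithms the normalizing constants cancel, and the factor
      \<open>- m\<close> reverses the inequality.\<close>
    then have "ln (\<Prod>i<n. pvii_density m (Y i \<omega> - t)) \<le> ln (\<Prod>i<n. pvii_density m (Y i \<omega> - T n \<omega>))"
      using pvii_density_pos[OF m] by (subst ln_le_cancel_iff) (auto intro!: prod_pos)
    then show "(\<Sum>i<n. excess (T n \<omega>) (Y i \<omega>)) \<le> (\<Sum>i<n. excess t (Y i \<omega>))"
      using m by (simp add: ln_prod_pvii_density[OF m] excess_def sum_subtractf)
  qed
  show ?thesis using T_asymptotically_normal by (simp add: T_def x_def)
qed

end
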